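(* Let $P$ be a bounded interval order of length at least $2$, let $A$ be its set of atoms, and let $a_0$ be its smallest atom, i.e. the unique minimum element of $A$ with respect to the partial order $\preceq$ on $A$ whose strict relation is: $a\prec b$ if $a$ has a cover in $P$ that is not greater than $b$. Then for all $i\ge 0$, $$\beta_i(P)=\sum_{a\in A\setminus\{a_0\}}\beta_{i-1}([a,\hat 1]).$$
   Context: All posets are finite. A poset is bounded if it has a minimum element $\hat 0$ and a maximum element $\hat 1$. The length of a bounded poset is the length (number of covering steps) of its longest chain from $\hat 0$ to $\hat 1$. Atoms are the elements covering $\hat 0$. A poset $P$ is an interval order if its elements $x$ can be assigned closed intervals $I_x$ of the real line so that $x<y$ in $P$ if and only if $\max I_x<\min I_y$; by a well-known characterization, this is equivalent to $P$ not containing, as an induced subposet, the $4$-element poset consisting of two disjoint $2$-element chains (with no relations between the two chains). The relation $\prec$ on the atoms of a bounded interval order is a strict partial order, and "the smallest atom" means the unique minimum atom in the corresponding partial order $\preceq$. For a bounded poset $P$ put $\bar P=P\setminus\{\hat 0,\hat 1\}$, let $\Delta(\bar P)$ be the order complex of $\bar P$ (the simplicial complex of all chains of $\bar P$, including the empty chain), and let $\beta_i(P)$ be the $i$-th reduced Betti number of $\Delta(\bar P)$, i.e. the rank of the reduced simplicial homology group $\tilde H_i(\Delta(\bar P);\mathbb Z)$. In particular, when $\bar P=\emptyset$ one has $\Delta(\bar P)=\{\emptyset\}$, $\beta_{-1}(P)=1$ and $\beta_i(P)=0$ for $i\neq -1$. The closed interval $[a,\hat 1]=\{x\in P: a\le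 x\le \hat 1\}$ is regarded as a bounded poset with minimum $a$ and maximum $\hat 1$. *)

theory Defs
  imports Complex_Main "HOL-Algebra.Free_Abelian_Groups"
begin

text \<open>
  A finite poset is a finite set \<open>P\<close> of elements of an order type, with the induced order. In this
  way a subset of \<open>P\<close> (an interval, the proper part) is again a poset.
\<close>

definition bounded_poset :: "'a::order set \<Rightarrow> bool" where
  "bounded_poset P \<longleftrightarrow> finite P \<and> (\<exists>b\<in>P. \<forall>x\<in>P. b \<le> x) \<and> (\<exists>t\<in>P. \<forall>x\<in>P. x \<le> t)"

definition poset_bot :: "'a::order set \<Rightarrow> 'a" where
  "poset_bot P = (LEAST x. x \<in> P)"

definition poset_top :: "'a::order set \<Rightarrow> 'a" where
  "poset_top P = (GREATEST x. x \<in> P)"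

definition proper_part :: "'a::order set \<Rightarrow> 'a set" where
  "proper_part P = P - {poset_bot P, poset_top P}"

text \<open>A chain with \<open>n\<close> elements has \<open>n - 1\<close> steps; a longest chain is saturated.\<close>

definition poset_length :: "'a::order set \<Rightarrow> nat" where
  "poset_length P =
     Max {card C - 1 |C. C \<subseteq> P \<and> Complete_Partial_Order.chain (\<le>) C \<and>
                          poset_bot P \<in> C \<and> poset_top P \<in> C}"

definition covered_by :: "'a::order set \<Rightarrow> 'a \<Rightarrow> 'a \<Rightarrow> bool" where
  "covered_by P x y \<longleftrightarrow> x \<in> P \<and> y \<in> P \<and> x < y \<and> \<not> (\<exists>z\<in>P. x < z \<and> z < y)"

definition poset_atoms :: "'a::order set \<Rightarrow> 'a set" where
  "poset_atoms P = {a. covered_by P (poset_bot P) a}"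

text \<open>The interval assigned to \<open>x\<close> is \<open>{l x..r x}\<close>.\<close>

definition interval_order :: "'a::order set \<Rightarrow> bool" where
  "interval_order P \<longleftrightarrow>
     (\<exists>l r :: 'a \<Rightarrow> real. (\<forall>x\<in>P. l x \<le> r x) \<and> (\<forall>x\<in>P. \<forall>y\<in>P. x < y \<longleftrightarrow> r x < l y))"

definition atom_less :: "'a::order set \<Rightarrow> 'a \<Rightarrow> 'a \<Rightarrow> bool" where
  "atom_less P a b \<longleftrightarrow> (\<exists>c. covered_by P a c \<and> \<not> b < c)"

definition atom_le :: "'a::order set \<Rightarrow> 'a \<Rightarrow> 'a \<Rightarrow> bool" where
  "atom_le P a b \<longleftrightarrow> a = b \<or> atom_less P a b"

definition smallest_atom :: "'a::order set \<Rightarrow> 'a \<Rightarrow> bool" where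
  "smallest_atom P a \<longleftrightarrow> a \<in> poset_atoms P \<and> (\<forall>b\<in>poset_atoms P. atom_le P a b)"

definition order_complex :: "'a::order set \<Rightarrow> 'a set set" where
  "order_complex Q = {C. C \<subseteq> Q \<and> finite C \<and> Complete_Partial_Order.chain (\<le>) C}"

text \<open>
  Reduced simplicial homology over the integers of a simplicial complex \<open>K\<close> (containing the empty
  simplex) each of whose simplices is a chain, oriented by listing its vertices in increasing order.
  Degrees are integers: the empty simplex has dimension -1, and the boundary map in degree 0 is
  the augmentation. In \<open>simplicial_boundary\<close>, the position of \<open>v\<close> in \<open>\<sigma>\<close> is the number of
  vertices of \<open>\<sigma>\<close> below \<open>v\<close>.
\<close>

definition simplicial_chain_group :: "int \<Rightarrow> 'a set set \<Rightarrow> ('a set \<Rightarrow>\<^sub>0 int) monoid" where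
  "simplicial_chain_group i K = free_Abelian_group {\<sigma>\<in>K. int (card \<sigma>) = i + 1}"

definition simplicial_boundary :: "('a::order set \<Rightarrow>\<^sub>0 int) \<Rightarrow> ('a set \<Rightarrow>\<^sub>0 int)" where
  "simplicial_boundary =
     frag_extend (\<lambda>\<sigma>. \<Sum>v\<in>\<sigma>. frag_cmul ((-1) ^ card {u\<in>\<sigma>. u < v}) (frag_of (\<sigma> - {v})))"

definition simplicial_cycles :: "int \<Rightarrow> 'a::order set set \<Rightarrow> ('a set \<Rightarrow>\<^sub>0 int) set" where
  "simplicial_cycles i K =
     kernel (simplicial_chain_group i K) (simplicial_chain_group (i - 1) K) simplicial_boundary"

definition simplicial_boundaries :: "int \<Rightarrow> 'a::order set set \<Rightarrow> ('a set \<Rightarrow>\<^sub>0 int) set" where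
  "simplicial_boundaries i K = simplicial_boundary ` carrier (simplicial_chain_group (i + 1) K)"

definition reduced_simplicial_homology ::
    "int \<Rightarrow> 'a::order set set \<Rightarrow> ('a set \<Rightarrow>\<^sub>0 int) set monoid" where
  "reduced_simplicial_homology i K =
     subgroup_generated (simplicial_chain_group i K) (simplicial_cycles i K)
       Mod simplicial_boundaries i K"

text \<open>
  The rank of a (multiplicatively written) abelian group: the largest size of a finite subset that
  is linearly independent over the integers. It is meant for groups of finite rank, such as
  finitely generated ones; otherwise the supremum is not meaningful.
\<close>

definition int_independent :: "('g, 'm) monoid_scheme \<Rightarrow> 'g set \<Rightarrow> bool" where
  "int_independent G B \<longleftrightarrow>
     (\<forall>c :: 'g \<Rightarrow> int. finprod G (\<lambda>x. x [^]\<^bsub>G\<^esub> c x) B = \<one>\<^bsub>G\<^esub> \<longrightarrow> (\<forall>x\<in>B. c x = 0))"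

definition abelian_group_rank :: "('g, 'm) monoid_scheme \<Rightarrow> nat" where
  "abelian_group_rank G = Sup {card B |B. finite B \<and> B \<subseteq> carrier G \<and> int_independent G B}"

definition reduced_betti :: "int \<Rightarrow> 'a::order set \<Rightarrow> nat" where
  "reduced_betti i P =
     abelian_group_rank (reduced_simplicial_homology i (order_complex (proper_part P)))"

end

theory Submission
  imports Defs
begin

text \<open>
  Let \<open>Q\<close> be the proper part of \<open>P\<close>. In an interval order the sets \<open>{x. a < x}\<close> are nested, and
  the one of the smallest atom \<open>p\<close> contains all others. So deleting the atoms \<open>a \<noteq> p\<close> from \<open>Q\<close>
  leaves a cone with apex \<open>p\<close>, and \<open>Q\<close> is obtained from it by gluing, for each such \<open>a\<close>, a cone
  with apex \<open>a\<close> over \<open>{x \<in> Q. a < x}\<close>. On chains: a cycle of \<open>Q\<close> is a boundary iff its link parts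
  at all \<open>a \<noteq> p\<close> are boundaries, and a cycle \<open>w\<close> above \<open>a\<close> is the link part at \<open>a\<close> of the cycle
  \<open>cone a w - cone p w\<close>, whose other link parts vanish.
\<close>

section \<open>Ranks of quotients of free abelian groups\<close>

text \<open>Gaussian elimination without division: cross-multiplying with a pivot removes one
  equation and one unknown at a time, so all coefficients stay integers.\<close>

lemma homogeneous_int_system_nontrivial:
  fixes M :: "'i \<Rightarrow> 'j \<Rightarrow> int"
  assumes "finite J" "finite I" "card J < card I"
  shows "\<exists>c. (\<exists>i\<in>I. c i \<noteq> 0) \<and> (\<forall>j\<in>J. (\<Sum>i\<in>I. c i * M i j) = 0)"
  using assms
proof (induction J arbitrary: I M rule: finite_induct)
  case empty
  then show ?case
    by (intro exI[of _ "\<lambda>_. 1"]) (use card_gt_0_iff in fastforce)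
next
  case (insert j J)
  show ?case
  proof (cases "\<forall>i\<in>I. M i j = 0")
    case True
    have "card J < card I"
      using insert by auto
    then obtain c where c: "\<exists>i\<in>I. c i \<noteq> 0" "\<forall>k\<in>J. (\<Sum>i\<in>I. c i * M i k) = 0"
      using insert.IH[OF insert.prems(1), of M] by blast
    have "(\<Sum>i\<in>I. c i * M i j) = 0"
      using True by simp
    with c show ?thesis
      by blast
  next
    case False
    then obtain p where p: "p \<in> I" "M p j \<noteq> 0"
      by blast
    define I' where "I' = I - {p}"
    have I': "finite I'" "I = insert p I'" "p \<notin> I'"
      using p insert.prems by (auto simp: I'_def)
    then have "card J < card I'"
      using insert by auto
    \<comment> \<open>The matrix \<open>M p j * M i k - M i j * M p k\<close> is what remains when
      column \<open>j\<close> is cleared by means of the pivot \<open>M p j\<close>.\<close>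
    then obtain c where c: "\<exists>i\<in>I'. c i \<noteq> 0"
      "\<And>k. k \<in> J \<Longrightarrow> (\<Sum>i\<in>I'. c i * (M p j * M i k - M i j * M p k)) = 0"
      using insert.IH[OF I'(1), of "\<lambda>i k. M p j * M i k - M i j * M p k"] by blast
    \<comment> \<open>Equation \<open>j\<close> determines the value at \<open>p\<close>; scaling
      the other unknowns by the pivot makes that value an integer.\<close>
    define d where "d i = (if i = p then - (\<Sum>i\<in>I'. c i * M i j) else M p j * c i)" for i
    have sum_d: "(\<Sum>i\<in>I. d i * M i k) = (\<Sum>i\<in>I'. c i * (M p j * M i k - M i j * M p k))" for k
    proof -
      have "(\<Sum>i\<in>I'. d i * M i k) = (\<Sum>i\<in>I'. M p j * c i * M i k)"
        using I' by (intro sum.cong) (auto simp: d_def)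
      then have "(\<Sum>i\<in>I. d i * M i k) = - (\<Sum>i\<in>I'. c i * M i j) * M p k + (\<Sum>i\<in>I'. M p j * c i * M i k)"
        using I' by (simp add: d_def)
      also have "\<dots> = (\<Sum>i\<in>I'. c i * (M p j * M i k - M i j * M p k))"
        by (simp add: sum_distrib_left sum_distrib_right right_diff_distrib sum_subtractf mult_ac)
      finally show ?thesis .
    qed
    have "(\<Sum>i\<in>I. d i * M i k) = 0" if "k \<in> insert j J" for k
      using that c(2) by (auto simp: sum_d mult_ac)
    moreover have "\<exists>i\<in>I. d i \<noteq> 0"
      using c(1) p I' by (auto simp: d_def)
    ultimately show ?thesis
      by blast
  qed
qed

section \<open>Rational bases modulo a subgroup\<close>

lemma frag_cmul_sum_left: "frag_cmul (sum c I) x = (\<Sum>i\<in>I. frag_cmul (c i) x)"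
  by (induction I rule: infinite_finite_induct) (auto simp: frag_cmul_distrib)

lemma frag_cmul_diff_right: "frag_cmul k (x - y) = frag_cmul k x - frag_cmul k y"
  using frag_cmul_distrib2[of k x "- y"] frag_cmul_cmul[of k "-1" y] by simp

definition frag_subgroup :: "('v \<Rightarrow>\<^sub>0 int) set \<Rightarrow> bool" where
  "frag_subgroup Z \<longleftrightarrow> 0 \<in> Z \<and> (\<forall>x\<in>Z. \<forall>y\<in>Z. x - y \<in> Z)"

lemma frag_subgroup_closed:
  assumes "frag_subgroup Z"
  shows frag_subgroup_zero: "0 \<in> Z"
    and frag_subgroup_diff: "x \<in> Z \<Longrightarrow> y \<in> Z \<Longrightarrow> x - y \<in> Z"
    and frag_subgroup_uminus: "x \<in> Z \<Longrightarrow> - x \<in> Z"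
    and frag_subgroup_add: "x \<in> Z \<Longrightarrow> y \<in> Z \<Longrightarrow> x + y \<in> Z"
    and frag_subgroup_cmul: "x \<in> Z \<Longrightarrow> frag_cmul k x \<in> Z"
    and frag_subgroup_sum: "(\<And>i. i \<in> I \<Longrightarrow> f i \<in> Z) \<Longrightarrow> sum f I \<in> Z"
proof -
  show zero: "0 \<in> Z" and diff: "x \<in> Z \<Longrightarrow> y \<in> Z \<Longrightarrow> x - y \<in> Z" for x y
    using assms by (auto simp: frag_subgroup_def)
  show uminus: "x \<in> Z \<Longrightarrow> - x \<in> Z" for x
    using diff[OF zero] by simp
  show add: "x \<in> Z \<Longrightarrow> y \<in> Z \<Longrightarrow> x + y \<in> Z" for x y
    using diff[OF _ uminus] by force
  show "x \<in> Z \<Longrightarrow> frag_cmul k x \<in> Z"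
    by (rule frag_closure_minus_cmul[where P = "\<lambda>x. x \<in> Z"]) (auto intro: zero diff)
  show "(\<And>i. i \<in> I \<Longrightarrow> f i \<in> Z) \<Longrightarrow> sum f I \<in> Z"
    by (induction I rule: infinite_finite_induct) (auto intro: zero add)
qed

text \<open>Stated for an indexed family rather than a set, so that for finite \<open>I\<close> two
  indices with the same class modulo \<open>B\<close> already count as a dependence.\<close>

definition independent_modulo ::
    "('v \<Rightarrow>\<^sub>0 int) set \<Rightarrow> ('i \<Rightarrow> ('v \<Rightarrow>\<^sub>0 int)) \<Rightarrow> 'i set \<Rightarrow> bool" where
  "independent_modulo B z I \<longleftrightarrow>
     (\<forall>c. (\<Sum>i\<in>I. frag_cmul (c i) (z i)) \<in> B \<longrightarrow> (\<forall>i\<in>I. c i = 0))"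

text \<open>The classes of the \<open>z i\<close> form a basis of the rational vector space \<open>(Z / B) \<otimes> \<rat>\<close>.\<close>

definition rational_basis_modulo ::
    "('v \<Rightarrow>\<^sub>0 int) set \<Rightarrow> ('v \<Rightarrow>\<^sub>0 int) set \<Rightarrow> ('i \<Rightarrow> ('v \<Rightarrow>\<^sub>0 int)) \<Rightarrow> 'i set \<Rightarrow> bool" where
  "rational_basis_modulo Z B z I \<longleftrightarrow> finite I \<and> z ` I \<subseteq> Z \<and> independent_modulo B z I \<and>
     (\<forall>w\<in>Z. \<exists>m d. m \<noteq> 0 \<and> frag_cmul m w - (\<Sum>i\<in>I. frag_cmul (d i) (z i)) \<in> B)"

text \<open>Steinitz bound. Modulo \<open>B\<close>, nonzero multiples of the \<open>y s\<close> are
  combinations of the \<open>z i\<close>. If there were more \<open>y s\<close> than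
  \<open>z i\<close>, the coefficient matrix would have a nontrivial integer kernel vector
  \<open>c\<close>, and the \<open>y s\<close> would satisfy a relation modulo \<open>B\<close> with
  coefficients \<open>c s * m s\<close>.\<close>

lemma independent_modulo_card_le:
  assumes B: "frag_subgroup B"
    and basis: "rational_basis_modulo Z B z I"
    and y: "finite S" "y ` S \<subseteq> Z" "independent_modulo B y S"
  shows "card S \<le> card I"
proof (rule ccontr)
  assume "\<not> card S \<le> card I"
  then have less: "card I < card S"
    by simp
  have "\<forall>s\<in>S. \<exists>m d. m \<noteq> 0 \<and> frag_cmul m (y s) - (\<Sum>i\<in>I. frag_cmul (d i) (z i)) \<in> B"
    using basis y unfolding rational_basis_modulo_def by blast
  then obtain m d where md: "\<And>s. s \<in> S \<Longrightarrow> m s \<noteq> 0"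
    "\<And>s. s \<in> S \<Longrightarrow> frag_cmul (m s) (y s) - (\<Sum>i\<in>I. frag_cmul (d s i) (z i)) \<in> B"
    by metis
  have "finite I"
    using basis by (simp add: rational_basis_modulo_def)
  with less y obtain c where c: "\<exists>s\<in>S. c s \<noteq> 0" "\<And>i. i \<in> I \<Longrightarrow> (\<Sum>s\<in>S. c s * d s i) = 0"
    using homogeneous_int_system_nontrivial[of I S d] by blast
  have "(\<Sum>s\<in>S. frag_cmul (c s) (\<Sum>i\<in>I. frag_cmul (d s i) (z i)))
      = (\<Sum>i\<in>I. frag_cmul (\<Sum>s\<in>S. c s * d s i) (z i))"
    by (simp add: frag_cmul_sum frag_cmul_sum_left) (rule sum.swap)
  also have "\<dots> = 0"
    using c by simp
  finally have "(\<Sum>s\<in>S. frag_cmul (c s) (frag_cmul (m s) (y s) - (\<Sum>i\<in>I. frag_cmul (d s i) (z i))))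
      = (\<Sum>s\<in>S. frag_cmul (c s * m s) (y s))"
    by (simp add: frag_cmul_diff_right sum_subtractf)
  moreover have "(\<Sum>s\<in>S. frag_cmul (c s) (frag_cmul (m s) (y s) - (\<Sum>i\<in>I. frag_cmul (d s i) (z i)))) \<in> B"
    using md by (intro frag_subgroup_sum[OF B] frag_subgroup_cmul[OF B])
  ultimately have "\<forall>s\<in>S. c s * m s = 0"
    using y(3) unfolding independent_modulo_def by metis
  then show False
    using c(1) md(1) by auto
qed

text \<open>An independent subset of \<open>Z\<close> of maximal size is a basis. The maximum exists
  because elements supported in \<open>K\<close> are integer vectors with \<open>card K\<close>
  coordinates: any larger finite set of them satisfies a nontrivial relation, whose value 0 lies in
  \<open>B\<close>.\<close>

lemma rational_basis_modulo_exists: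
  fixes Z :: "('v \<Rightarrow>\<^sub>0 int) set"
  assumes B: "frag_subgroup B" and K: "finite K" "\<And>x. x \<in> Z \<Longrightarrow> Poly_Mapping.keys x \<subseteq> K"
  shows "\<exists>E. rational_basis_modulo Z B (\<lambda>x. x) E"
proof -
  define indep where "indep E \<longleftrightarrow> finite E \<and> E \<subseteq> Z \<and> independent_modulo B (\<lambda>x. x) E"
    for E :: "('v \<Rightarrow>\<^sub>0 int) set"
  have bound: "card E \<le> card K" if "indep E" for E
  proof (rule ccontr)
    assume "\<not> card E \<le> card K"
    then have "card K < card E" "finite E"
      using that by (auto simp: indep_def)
    then obtain c where c: "\<exists>x\<in>E. c x \<noteq> 0"
      "\<And>k. k \<in> K \<Longrightarrow> (\<Sum>x\<in>E. c x * Poly_Mapping.lookup x k) = 0"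
      using homogeneous_int_system_nontrivial[of K E Poly_Mapping.lookup] K(1) by blast
    have "(\<Sum>x\<in>E. c x * Poly_Mapping.lookup x k) = 0" if "k \<notin> K" for k
      using that K(2) \<open>indep E\<close> unfolding indep_def
      by (intro sum.neutral) (metis in_keys_iff mult_zero_right subsetD)
    with c(2) have "(\<Sum>x\<in>E. c x * Poly_Mapping.lookup x k) = 0" for k
      by blast
    then have "(\<Sum>x\<in>E. frag_cmul (c x) x) = 0"
      by (intro poly_mapping_eqI) (simp add: lookup_sum)
    then show False
      using \<open>indep E\<close> frag_subgroup_zero[OF B] c(1) unfolding indep_def independent_modulo_def by metis
  qed
  have "indep {}"
    by (simp add: indep_def independent_modulo_def)
  then obtain E where E: "indep E" and max: "\<And>F. indep F \<Longrightarrow> card F \<le> card E"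
    using ex_has_greatest_nat[of indep "{}" card "Suc (card K)"] bound le_imp_less_Suc by blast
  have "\<exists>m d. m \<noteq> 0 \<and> frag_cmul m w - (\<Sum>x\<in>E. frag_cmul (d x) x) \<in> B" if w: "w \<in> Z" for w
  proof (cases "w \<in> E")
    case True
    then have "(\<Sum>x\<in>E. frag_cmul (if x = w then 1 else 0) x) = w"
      using E by (subst sum.remove[of _ w]) (auto simp: indep_def)
    then show ?thesis
      using frag_subgroup_zero[OF B]
      by (intro exI[of _ 1] exI[of _ "\<lambda>x. if x = w then 1 else 0"]) simp
  next
    case False
    have "\<not> indep (insert w E)"
      using max[of "insert w E"] False E by (auto simp: indep_def)
    then obtain c where c: "(\<Sum>x\<in>insert w E. frag_cmul (c x) x) \<in> B" "\<exists>x\<in>insert w E. c x \<noteq> 0"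
      using E w unfolding indep_def independent_modulo_def by blast
    have *: "frag_cmul (c w) w + (\<Sum>x\<in>E. frag_cmul (c x) x) \<in> B"
      using c(1) E False by (simp add: indep_def)
    \<comment> \<open>With coefficient 0 at \<open>w\<close> the relation would live on
      \<open>E\<close> alone, contradicting independence. So \<open>c w\<close> can serve as the
      multiplier of \<open>w\<close>.\<close>
    have "c w \<noteq> 0"
    proof
      assume "c w = 0"
      with * E have "\<forall>x\<in>E. c x = 0"
        unfolding indep_def independent_modulo_def by simp
      with c(2) \<open>c w = 0\<close> show False
        by auto
    qed
    moreover have "(\<Sum>x\<in>E. frag_cmul (- c x) x) = - (\<Sum>x\<in>E. frag_cmul (c x) x)"
      by (simp flip: sum_negf)
    ultimately show ?thesis
      using * by (intro exI[of _ "c w"] exI[of _ "\<lambda>x. - c x"]) simp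
  qed
  then have "rational_basis_modulo Z B (\<lambda>x. x) E"
    using E by (auto simp: rational_basis_modulo_def indep_def)
  then show ?thesis ..
qed

section \<open>From rational bases to ranks of quotient groups\<close>

lemma subgroup_free_Abelian_group:
  assumes "frag_subgroup Z" "Z \<subseteq> carrier (free_Abelian_group T)"
  shows "subgroup Z (free_Abelian_group T)"
proof (rule group.subgroupI)
  show "inv\<^bsub>free_Abelian_group T\<^esub> x \<in> Z" if "x \<in> Z" for x
    using that assms frag_subgroup_uminus[OF assms(1) that]
    by (subst inv_free_Abelian_group) (auto simp: subset_iff)
qed (use assms frag_subgroup_zero[OF assms(1)] in \<open>auto intro: frag_subgroup_add\<close>)

text \<open>The projection \<open>h\<close> onto the quotient turns integer combinations in
  \<open>Z\<close> into products of powers and has kernel \<open>B\<close>. Hence independence in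
  the quotient is independence modulo \<open>B\<close>, to which the Steinitz bound applies, and the
  classes of the basis attain the bound.\<close>

lemma abelian_group_rank_quotient:
  fixes Z :: "('v \<Rightarrow>\<^sub>0 int) set" and z :: "'i \<Rightarrow> 'v \<Rightarrow>\<^sub>0 int"
  assumes Z: "frag_subgroup Z" "Z \<subseteq> carrier (free_Abelian_group T)"
    and B: "frag_subgroup B" "B \<subseteq> Z"
    and basis: "rational_basis_modulo Z B z I"
  shows "abelian_group_rank (subgroup_generated (free_Abelian_group T) Z Mod B) = card I"
proof -
  let ?F = "free_Abelian_group T" and ?H = "subgroup_generated (free_Abelian_group T) Z"
  let ?G = "?H Mod B"
  have sub_Z: "subgroup Z ?F"
    by (rule subgroup_free_Abelian_group[OF Z])
  have carrier_H: "carrier ?H = Z"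
    using sub_Z by (rule subgroup.carrier_subgroup_generated_subgroup)
  interpret H: comm_group ?H
    by (intro group.abelian_subgroup_generated abelian_free_Abelian_group group_free_Abelian_group)
  have "subgroup B ?F"
    using Z B by (intro subgroup_free_Abelian_group) auto
  then have "subgroup B ?H"
    using sub_Z B by (simp add: group.subgroup_of_subgroup_generated)
  then interpret normal B ?H
    by (rule H.normal_iff_subgroup[THEN iffD2])
  interpret G: comm_group ?G
    using \<open>subgroup B ?H\<close> by (rule H.abelian_FactGroup)
  define h where "h = (\<lambda>x. B #>\<^bsub>?H\<^esub> x)"
  interpret h: group_hom ?H ?G h
    unfolding h_def using r_coset_hom_Mod by unfold_locales
  have h_one: "h x = \<one>\<^bsub>?G\<^esub> \<longleftrightarrow> x \<in> B" if "x \<in> Z" for x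
    using that \<open>subgroup B ?H\<close> carrier_H H.coset_join1[of B x] H.coset_join2[of x B]
    unfolding h_def by auto
  have h_cmul: "h (frag_cmul k x) = h x [^]\<^bsub>?G\<^esub> k" if "x \<in> Z" for k x
  proof -
    have "x [^]\<^bsub>?H\<^esub> k = x [^]\<^bsub>?F\<^esub> k"
      using that sub_Z by (simp add: group.int_pow_subgroup_generated carrier_H)
    also have "\<dots> = frag_cmul k x"
      using that Z by (subst int_pow_free_Abelian_group) (auto simp: subset_iff)
    finally show ?thesis
      using h.hom_int_pow[of x k] that carrier_H by simp
  qed
  have finprod: "finprod ?G (\<lambda>i. h (y i) [^]\<^bsub>?G\<^esub> c i) S = h (\<Sum>i\<in>S. frag_cmul (c i) (y i))"
    if "finite S" "y ` S \<subseteq> Z" for S :: "'j set" and y c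
    using that
  proof (induction S rule: finite_induct)
    case empty
    then show ?case
      using h_one[of 0] frag_subgroup_zero[OF Z(1)] frag_subgroup_zero[OF B(1)]
      by simp
  next
    case (insert s S)
    have "h (frag_cmul (c s) (y s) + (\<Sum>i\<in>S. frag_cmul (c i) (y i)))
        = h (frag_cmul (c s) (y s)) \<otimes>\<^bsub>?G\<^esub> h (\<Sum>i\<in>S. frag_cmul (c i) (y i))"
      using insert.prems Z(1) carrier_H
      by (subst h.hom_mult[symmetric])
        (auto intro!: frag_subgroup_cmul frag_subgroup_sum)
    then show ?case
      using insert carrier_H by (simp add: G.finprod_insert Pi_iff h_cmul image_subset_iff)
  qed
  have in_Z: "(\<Sum>i\<in>S. frag_cmul (c i) (y i)) \<in> Z" if "y ` S \<subseteq> Z" for S :: "'j set" and y c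
    using that Z(1) by (auto intro!: frag_subgroup_sum frag_subgroup_cmul)
  have inv_h: "inv_into Z h X \<in> Z" "h (inv_into Z h X) = X" if "X \<in> carrier ?G" for X
    using that unfolding carrier_FactGroup carrier_H h_def[symmetric]
    by (simp_all add: inv_into_into f_inv_into_f)
  \<comment> \<open>An independent set of classes is lifted to chosen representatives in
    \<open>Z\<close>.\<close>
  have le: "card X \<le> card I" if X: "finite X" "X \<subseteq> carrier ?G" "int_independent ?G X" for X
  proof (rule independent_modulo_card_le[OF B(1) basis X(1)])
    show sub: "inv_into Z h ` X \<subseteq> Z"
      using X inv_h by auto
    have "finprod ?G (\<lambda>x. x [^]\<^bsub>?G\<^esub> c x) X = h (\<Sum>x\<in>X. frag_cmul (c x) (inv_into Z h x))" for c
      unfolding finprod[OF X(1) sub, symmetric]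
      using X by (intro G.finprod_cong) (auto simp: inv_h subset_iff)
    then show "independent_modulo B (inv_into Z h) X"
      using X(3) h_one in_Z[OF sub] unfolding independent_modulo_def int_independent_def by simp
  qed
  have I: "finite I" "z ` I \<subseteq> Z" "independent_modulo B z I"
    using basis by (auto simp: rational_basis_modulo_def)
  \<comment> \<open>Independence in the quotient concerns sets, so the classes of the basis must be
    distinct to number \<open>card I\<close>. Two equal classes would give a relation with
    coefficients 1 and -1.\<close>
  have inj: "inj_on (\<lambda>i. h (z i)) I"
  proof
    fix i j assume ij: "i \<in> I" "j \<in> I" "h (z i) = h (z j)"
    show "i = j"
    proof (rule ccontr)
      assume "i \<noteq> j"
      define c :: "'i \<Rightarrow> int" where "c k = (if k = i then 1 else if k = j then -1 else 0)" for k
      have sum_c: "(\<Sum>k\<in>I. frag_cmul (c k) (z k)) = z i - z j"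
      proof -
        have "(\<Sum>k\<in>I. frag_cmul (c k) (z k)) = (\<Sum>k\<in>{i, j}. frag_cmul (c k) (z k))"
          using ij I by (intro sum.mono_neutral_right) (auto simp: c_def)
        then show ?thesis
          using \<open>i \<noteq> j\<close> by (simp add: c_def)
      qed
      have "z i - z j \<in> Z" "z j \<in> Z"
        using ij I Z(1) by (auto intro: frag_subgroup_diff)
      then have "h (z i - z j) \<otimes>\<^bsub>?G\<^esub> h (z j) = h (z i)"
        using h.hom_mult[of "z i - z j" "z j"] carrier_H by simp
      then have "h (z i - z j) = \<one>\<^bsub>?G\<^esub>"
        using G.r_cancel_one[OF h.hom_closed h.hom_closed, of "z j" "z i - z j"]
          ij(3) \<open>z i - z j \<in> Z\<close> \<open>z j \<in> Z\<close> carrier_H by simp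
      then have "\<forall>k\<in>I. c k = 0"
        using I(3) h_one[OF \<open>z i - z j \<in> Z\<close>] sum_c unfolding independent_modulo_def by metis
      then show False
        using ij by (auto simp: c_def)
    qed
  qed
  have "int_independent ?G ((\<lambda>i. h (z i)) ` I)"
    unfolding int_independent_def
  proof (intro allI impI)
    fix c :: "_ \<Rightarrow> int"
    assume *: "finprod ?G (\<lambda>x. x [^]\<^bsub>?G\<^esub> c x) ((\<lambda>i. h (z i)) ` I) = \<one>\<^bsub>?G\<^esub>"
    have "finprod ?G (\<lambda>x. x [^]\<^bsub>?G\<^esub> c x) ((\<lambda>i. h (z i)) ` I)
        = h (\<Sum>i\<in>I. frag_cmul (c (h (z i))) (z i))"
      using inj I carrier_H by (subst G.finprod_reindex) (auto simp: finprod)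
    with * have "(\<Sum>i\<in>I. frag_cmul (c (h (z i))) (z i)) \<in> B"
      using h_one[OF in_Z[OF I(2)]] by simp
    then have "\<forall>i\<in>I. c (h (z i)) = 0"
      using I(3)[unfolded independent_modulo_def, rule_format, of "\<lambda>i. c (h (z i))"] by blast
    then show "\<forall>x\<in>(\<lambda>i. h (z i)) ` I. c x = 0"
      by auto
  qed
  then have "card I \<in> {card X |X. finite X \<and> X \<subseteq> carrier ?G \<and> int_independent ?G X}"
    using I carrier_H card_image[OF inj, symmetric]
    by (intro CollectI exI[of _ "(\<lambda>i. h (z i)) ` I"]) auto
  then show ?thesis
    unfolding abelian_group_rank_def using le by (intro cSup_eq_maximum) auto
qed

text \<open>The projections \<open>frag_extend (f a)\<close> jointly detect membership in
  \<open>B\<close>, and \<open>\<psi> a\<close> is a section of the projection at \<open>a\<close>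
  that is invisible to the others. So \<open>Z\<close> modulo \<open>B\<close> behaves like the
  direct sum of the \<open>Z' a\<close> modulo \<open>B' a\<close>, and the disjoint union of their
  bases is carried to a basis by the sections.\<close>

lemma rational_basis_modulo_Sigma:
  fixes \<psi> :: "'a \<Rightarrow> ('w \<Rightarrow>\<^sub>0 int) \<Rightarrow> ('v \<Rightarrow>\<^sub>0 int)"
  assumes A: "finite A" and Z: "frag_subgroup Z"
    and B': "\<And>a. a \<in> A \<Longrightarrow> frag_subgroup (B' a)"
    and basis: "\<And>a. a \<in> A \<Longrightarrow> rational_basis_modulo (Z' a) (B' a) (\<lambda>x. x) (E a)"
    and \<phi>: "\<And>a w. a \<in> A \<Longrightarrow> w \<in> Z \<Longrightarrow> frag_extend (f a) w \<in> Z' a"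
    and \<psi>: "\<And>a w. a \<in> A \<Longrightarrow> w \<in> Z' a \<Longrightarrow> \<psi> a w \<in> Z"
    and \<phi>\<psi>: "\<And>a b w. a \<in> A \<Longrightarrow> b \<in> A \<Longrightarrow> w \<in> Z' a \<Longrightarrow>
      frag_extend (f b) (\<psi> a w) = (if b = a then w else 0)"
    and B: "\<And>w. w \<in> Z \<Longrightarrow> w \<in> B \<longleftrightarrow> (\<forall>a\<in>A. frag_extend (f a) w \<in> B' a)"
  shows "rational_basis_modulo Z B (\<lambda>(a, x). \<psi> a x) (Sigma A E)"
proof -
  have E: "finite (E a)" "E a \<subseteq> Z' a" "independent_modulo (B' a) (\<lambda>x. x) (E a)" if "a \<in> A" for a
    using basis[OF that] by (auto simp: rational_basis_modulo_def)
  have fin: "finite (Sigma A E)"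
    using A E by auto
  have sub: "(\<lambda>(a, x). \<psi> a x) ` Sigma A E \<subseteq> Z"
    using E(2) \<psi> by auto
  have sum_in: "(\<Sum>p\<in>Sigma A E. frag_cmul (c p) (case p of (a, x) \<Rightarrow> \<psi> a x)) \<in> Z" for c
    using sub Z by (intro frag_subgroup_sum frag_subgroup_cmul) auto
  \<comment> \<open>The projection at \<open>b\<close> kills all summands with first index other
    than \<open>b\<close>.\<close>
  have extend_sum: "frag_extend (f b) (\<Sum>p\<in>Sigma A E. frag_cmul (c p) (case p of (a, x) \<Rightarrow> \<psi> a x))
      = (\<Sum>x\<in>E b. frag_cmul (c (b, x)) x)" if b: "b \<in> A" for b c
  proof -
    have "frag_extend (f b) (\<Sum>p\<in>Sigma A E. frag_cmul (c p) (case p of (a, x) \<Rightarrow> \<psi> a x))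
        = (\<Sum>(a, x)\<in>Sigma A E. frag_cmul (c (a, x)) (frag_extend (f b) (\<psi> a x)))"
      using fin by (auto simp: frag_extend_sum frag_extend_cmul intro!: sum.cong)
    also have "\<dots> = (\<Sum>(a, x)\<in>Sigma A E. frag_cmul (c (a, x)) (if b = a then x else 0))"
      using E(2) \<phi>\<psi>[OF _ b] by (intro sum.cong) (auto simp: subset_iff)
    also have "\<dots> = (\<Sum>a\<in>A. \<Sum>x\<in>E a. frag_cmul (c (a, x)) (if b = a then x else 0))"
      using A E by (subst sum.Sigma) auto
    also have "\<dots> = (\<Sum>a\<in>A. if b = a then \<Sum>x\<in>E a. frag_cmul (c (a, x)) x else 0)"
      by (intro sum.cong) auto
    also have "\<dots> = (\<Sum>x\<in>E b. frag_cmul (c (b, x)) x)"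
      using A b by simp
    finally show ?thesis .
  qed
  have "c (a, x) = 0" if c: "(\<Sum>p\<in>Sigma A E. frag_cmul (c p) (case p of (a, x) \<Rightarrow> \<psi> a x)) \<in> B"
    and ax: "a \<in> A" "x \<in> E a" for c a x
  proof -
    have "(\<Sum>x\<in>E a. frag_cmul (c (a, x)) x) \<in> B' a"
      using c B[OF sum_in] ax extend_sum[of a c] by auto
    then show ?thesis
      using E(3)[OF ax(1), unfolded independent_modulo_def, rule_format, of "\<lambda>x. c (a, x)"] ax by blast
  qed
  then have indep: "independent_modulo B (\<lambda>(a, x). \<psi> a x) (Sigma A E)"
    unfolding independent_modulo_def by blast
  have "\<exists>m d. m \<noteq> 0 \<and>
      frag_cmul m w - (\<Sum>p\<in>Sigma A E. frag_cmul (d p) (case p of (a, x) \<Rightarrow> \<psi> a x)) \<in> B"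
    if w: "w \<in> Z" for w
  proof -
    have "\<forall>a\<in>A. \<exists>m d. m \<noteq> 0 \<and>
        frag_cmul m (frag_extend (f a) w) - (\<Sum>x\<in>E a. frag_cmul (d x) x) \<in> B' a"
      using basis \<phi> w unfolding rational_basis_modulo_def by blast
    then obtain m d where md: "\<And>a. a \<in> A \<Longrightarrow> m a \<noteq> 0"
      "\<And>a. a \<in> A \<Longrightarrow>
        frag_cmul (m a) (frag_extend (f a) w) - (\<Sum>x\<in>E a. frag_cmul (d a x) x) \<in> B' a"
      by metis
    \<comment> \<open>\<open>M\<close> is a common multiple of the multipliers \<open>m a\<close>
      belonging to the single components; \<open>D\<close> rescales the coefficients at
      \<open>a\<close> by the remaining factor.\<close>
    define M where "M = prod m A"
    define D where "D = (\<lambda>(a, x). prod m (A - {a}) * d a x)"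
    let ?r = "frag_cmul M w - (\<Sum>p\<in>Sigma A E. frag_cmul (D p) (case p of (a, x) \<Rightarrow> \<psi> a x))"
    have "frag_extend (f a) ?r \<in> B' a" if a: "a \<in> A" for a
    proof -
      have "frag_extend (f a) ?r
          = frag_cmul (prod m (A - {a}))
              (frag_cmul (m a) (frag_extend (f a) w) - (\<Sum>x\<in>E a. frag_cmul (d a x) x))"
        using A a
        by (simp add: frag_extend_diff extend_sum frag_extend_cmul frag_cmul_diff_right frag_cmul_sum
            M_def D_def prod.remove[of A a] mult_ac)
      then show ?thesis
        using md(2)[OF a] B'[OF a] by (simp add: frag_subgroup_cmul)
    qed
    moreover have "?r \<in> Z"
      using Z w sum_in by (intro frag_subgroup_diff frag_subgroup_cmul)
    moreover have "M \<noteq> 0"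
      using A md(1) by (simp add: M_def)
    ultimately show ?thesis
      using B by blast
  qed
  then show ?thesis
    using fin sub indep unfolding rational_basis_modulo_def by blast
qed

section \<open>Cones and links of simplicial chains\<close>

lemma simplicial_boundary_linear [simp]:
  "simplicial_boundary 0 = 0"
  "simplicial_boundary (x + y) = simplicial_boundary x + simplicial_boundary y"
  "simplicial_boundary (x - y) = simplicial_boundary x - simplicial_boundary y"
  "simplicial_boundary (- x) = - simplicial_boundary x"
  by (simp_all add: simplicial_boundary_def frag_extend_add frag_extend_diff frag_extend_minus)

lemma keys_simplicial_boundary:
  "Poly_Mapping.keys (simplicial_boundary c) \<subseteq> (\<Union>\<sigma>\<in>Poly_Mapping.keys c. (\<lambda>v. \<sigma> - {v}) ` \<sigma>)"
proof -
  have "Poly_Mapping.keys (\<Sum>v\<in>\<sigma>. frag_cmul ((-1) ^ card {u\<in>\<sigma>. u < v}) (frag_of (\<sigma> - {v})))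
      \<subseteq> (\<lambda>v. \<sigma> - {v}) ` \<sigma>" for \<sigma> :: "'a set"
    by (rule order_trans[OF keys_sum]) auto
  then show ?thesis
    unfolding simplicial_boundary_def by (intro order_trans[OF keys_frag_extend] UN_mono subset_refl)
qed

text \<open>Meant for chains whose vertices all lie above \<open>a\<close>: the new vertex then
  comes first in the increasing listing, so no sign is attached.\<close>

definition cone :: "'a \<Rightarrow> ('a set \<Rightarrow>\<^sub>0 int) \<Rightarrow> ('a set \<Rightarrow>\<^sub>0 int)" where
  "cone a = frag_extend (\<lambda>\<sigma>. frag_of (insert a \<sigma>))"

lemma cone_linear [simp]:
  "cone a 0 = 0"
  "cone a (x + y) = cone a x + cone a y"
  "cone a (x - y) = cone a x - cone a y"
  "cone a (- x) = - cone a x"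
  "cone a (frag_of \<sigma>) = frag_of (insert a \<sigma>)"
  by (simp_all add: cone_def frag_extend_add frag_extend_diff frag_extend_minus)

lemma keys_cone: "Poly_Mapping.keys (cone a c) \<subseteq> insert a ` Poly_Mapping.keys c"
  unfolding cone_def by (rule order_trans[OF keys_frag_extend]) auto

definition simplices_above :: "'a::order \<Rightarrow> 'a set set" where
  "simplices_above a = {\<sigma>. finite \<sigma> \<and> (\<forall>x\<in>\<sigma>. a < x)}"

lemma keys_simplicial_boundary_above:
  assumes "Poly_Mapping.keys c \<subseteq> simplices_above a"
  shows "Poly_Mapping.keys (simplicial_boundary c) \<subseteq> simplices_above a"
  using assms by (intro order_trans[OF keys_simplicial_boundary]) (auto simp: simplices_above_def)

text \<open>Deleting the first vertex \<open>a\<close> gives back \<open>\<sigma>\<close> with sign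
  +1. Every other vertex has its position raised by one through the presence of \<open>a\<close>, so
  the remaining faces appear with opposite sign.\<close>

lemma simplicial_boundary_cone:
  fixes a :: "'a::order"
  assumes "Poly_Mapping.keys c \<subseteq> simplices_above a"
  shows "simplicial_boundary (cone a c) = c - cone a (simplicial_boundary c)"
  using assms
proof (induction c rule: frag_induction)
  case (one \<sigma>)
  then have \<sigma>: "finite \<sigma>" "\<And>x. x \<in> \<sigma> \<Longrightarrow> a < x"
    by (auto simp: simplices_above_def)
  then have a: "a \<notin> \<sigma>"
    by blast
  have below: "(-1) ^ card {u \<in> insert a \<sigma>. u < v} = (- ((-1) ^ card {u \<in> \<sigma>. u < v}) :: int)"
    "insert a \<sigma> - {v} = insert a (\<sigma> - {v})" if "v \<in> \<sigma>" for v
  proof -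
    have "{u \<in> insert a \<sigma>. u < v} = insert a {u \<in> \<sigma>. u < v}"
      using that \<sigma> by auto
    then have "card {u \<in> insert a \<sigma>. u < v} = Suc (card {u \<in> \<sigma>. u < v})"
      using \<sigma>(1) a by (simp only: card_insert_disjoint finite_Collect_conjI mem_Collect_eq) simp
    then show "(-1) ^ card {u \<in> insert a \<sigma>. u < v} = (- ((-1) ^ card {u \<in> \<sigma>. u < v}) :: int)"
      by (simp only: power_Suc mult_minus1)
    show "insert a \<sigma> - {v} = insert a (\<sigma> - {v})"
      using that a by auto
  qed
  have "{u \<in> insert a \<sigma>. u < a} = {}"
    using \<sigma> by (auto dest: less_asym)
  then have below_a: "(-1) ^ card {u \<in> insert a \<sigma>. u < a} = (1::int)"
    by (simp only: card.empty power_0)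
  have insert_a: "insert a \<sigma> - {a} = \<sigma>"
    using a by simp
  have "simplicial_boundary (cone a (frag_of \<sigma>))
      = (\<Sum>v\<in>insert a \<sigma>. frag_cmul ((-1) ^ card {u \<in> insert a \<sigma>. u < v}) (frag_of (insert a \<sigma> - {v})))"
    by (simp add: simplicial_boundary_def)
  also have "\<dots> = frag_of \<sigma>
      + (\<Sum>v\<in>\<sigma>. frag_cmul ((-1) ^ card {u \<in> insert a \<sigma>. u < v}) (frag_of (insert a \<sigma> - {v})))"
    by (simp only: sum.insert[OF \<sigma>(1) a] below_a insert_a frag_cmul_one)
  also have "(\<Sum>v\<in>\<sigma>. frag_cmul ((-1) ^ card {u \<in> insert a \<sigma>. u < v}) (frag_of (insert a \<sigma> - {v})))
      = (\<Sum>v\<in>\<sigma>. - frag_cmul ((-1) ^ card {u \<in> \<sigma>. u < v}) (frag_of (insert a (\<sigma> - {v}))))"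
    by (intro sum.cong refl) (simp only: below minus_frag_cmul)
  also have "\<dots> = - cone a (simplicial_boundary (frag_of \<sigma>))"
    using \<sigma> by (simp add: simplicial_boundary_def cone_def frag_extend_sum frag_extend_cmul o_def
        flip: sum_negf)
  finally show ?case
    by simp
qed auto

lemma finite_chain_least:
  fixes \<sigma> :: "'a::order set"
  assumes "finite \<sigma>" "Complete_Partial_Order.chain (\<le>) \<sigma>" "\<sigma> \<noteq> {}"
  obtains a where "a \<in> \<sigma>" "\<And>x. x \<in> \<sigma> \<Longrightarrow> a \<le> x"
proof -
  obtain a where "a \<in> \<sigma>" "\<And>x. x \<in> \<sigma> \<Longrightarrow> x \<le> a \<Longrightarrow> a = x"
    using finite_has_minimal[OF assms(1,3)] by blast
  with assms(2) that show thesis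
    by (metis chainD)
qed

text \<open>Induction on the number of vertices instead of cancellation in a double sum. A nonempty
  chain is the cone over the rest \<open>\<tau>\<close> with its least vertex as apex; applying the
  cone formula twice leaves the cone over the double boundary of \<open>\<tau>\<close>, which is
  0.\<close>

lemma simplicial_boundary_boundary:
  fixes c :: "'a::order set \<Rightarrow>\<^sub>0 int"
  assumes "Poly_Mapping.keys c \<subseteq> order_complex Q"
  shows "simplicial_boundary (simplicial_boundary c) = 0"
  using assms
proof (induction c rule: frag_induction)
  case (one \<sigma>)
  then have "finite \<sigma>" "Complete_Partial_Order.chain (\<le>) \<sigma>"
    by (auto simp: order_complex_def)
  then show ?case
  proof (induction "card \<sigma>" arbitrary: \<sigma>)
    case 0
    then show ?case
      by (simp add: simplicial_boundary_def)
  next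
    case (Suc n)
    then obtain a where a: "a \<in> \<sigma>" "\<And>x. x \<in> \<sigma> \<Longrightarrow> a \<le> x"
      by (metis card.empty finite_chain_least nat.distinct(1))
    define \<tau> where "\<tau> = \<sigma> - {a}"
    have \<tau>: "frag_of \<sigma> = cone a (frag_of \<tau>)"
      using a by (auto simp: \<tau>_def insert_absorb)
    have "card \<tau> = n" "finite \<tau>" "Complete_Partial_Order.chain (\<le>) \<tau>"
      using Suc a by (auto simp: \<tau>_def chain_def)
    then have IH: "simplicial_boundary (simplicial_boundary (frag_of \<tau>)) = 0"
      using Suc by blast
    have keys: "Poly_Mapping.keys (frag_of \<tau>) \<subseteq> simplices_above a"
      using a Suc.prems by (auto simp: simplices_above_def \<tau>_def less_le)
    show ?case
      unfolding \<tau> using keys keys_simplicial_boundary_above[OF keys]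
      by (simp add: simplicial_boundary_cone IH del: cone_linear(5))
  qed
qed auto

section \<open>Links of vertices and contraction of cones\<close>

definition link_part :: "'a \<Rightarrow> 'a set \<Rightarrow> ('a set \<Rightarrow>\<^sub>0 int)" where
  "link_part a \<sigma> = (if a \<in> \<sigma> then frag_of (\<sigma> - {a}) else 0)"

lemma link_part_simps:
  "a \<in> \<sigma> \<Longrightarrow> link_part a \<sigma> = frag_of (\<sigma> - {a})"
  "a \<notin> \<sigma> \<Longrightarrow> link_part a \<sigma> = 0"
  by (simp_all add: link_part_def)

lemma link_part_linear [simp]:
  "frag_extend (link_part a) (x + y) = frag_extend (link_part a) x + frag_extend (link_part a) y"
  "frag_extend (link_part a) (x - y) = frag_extend (link_part a) x - frag_extend (link_part a) y"
  "frag_extend (link_part a) (- x) = - frag_extend (link_part a) x"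
  by (simp_all add: frag_extend_add frag_extend_diff frag_extend_minus)

text \<open>Removing \<open>a\<close> is injective on simplices containing \<open>a\<close>, so
  nothing cancels. This serves to conclude that a chain whose link part at \<open>a\<close> vanishes
  has no simplex through \<open>a\<close>.\<close>

lemma lookup_link_part:
  "Poly_Mapping.lookup (frag_extend (link_part a) c) \<tau>
    = (if a \<in> \<tau> then 0 else Poly_Mapping.lookup c (insert a \<tau>))"
proof -
  have "Poly_Mapping.keys c \<subseteq> UNIV"
    by simp
  then show ?thesis
  proof (induction c rule: frag_induction)
    case (one \<sigma>)
    then show ?case
      by (cases "a \<in> \<sigma>") (auto simp: link_part_simps)
  qed (auto simp: lookup_minus)
qed

lemma keys_link_part:
  "Poly_Mapping.keys (frag_extend (link_part a) c)
    \<subseteq> (\<lambda>\<sigma>. \<sigma> - {a}) ` {\<sigma> \<in> Poly_Mapping.keys c. a \<in> \<sigma>}"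
  by (rule order_trans[OF keys_frag_extend]) (auto simp: link_part_def split: if_splits)

lemma link_part_eq_0:
  assumes "\<And>\<sigma>. \<sigma> \<in> Poly_Mapping.keys c \<Longrightarrow> a \<notin> \<sigma>"
  shows "frag_extend (link_part a) c = 0"
  using assms by (intro frag_extend_eq_0) (auto simp: link_part_simps)

lemma link_part_cone:
  assumes "\<And>\<sigma>. \<sigma> \<in> Poly_Mapping.keys c \<Longrightarrow> a \<notin> \<sigma>"
  shows "frag_extend (link_part a) (cone a c) = c"
proof -
  have "Poly_Mapping.keys c \<subseteq> {\<sigma>. a \<notin> \<sigma>}"
    using assms by auto
  then show ?thesis
    by (induction c rule: frag_induction) (auto simp: link_part_simps)
qed

lemma order_complex_Diff_minimal:
  assumes "\<sigma> \<in> order_complex Q" "a \<in> \<sigma>" "\<And>x. x \<in> Q \<Longrightarrow> \<not> x < a"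
  shows "\<sigma> - {a} \<in> order_complex {x \<in> Q. a < x}"
  using assms by (auto simp: order_complex_def chain_def) (metis less_le subsetD)

lemma order_complex_above: "order_complex {x \<in> Q. a < x} \<subseteq> simplices_above a"
  by (auto simp: order_complex_def simplices_above_def)

text \<open>A simplex through the minimal element \<open>a\<close> is a cone with apex
  \<open>a\<close>. In the cone formula the face opposite to \<open>a\<close> has no link part, and
  the other term contributes minus the boundary of the link. For a simplex avoiding \<open>a\<close>
  both sides vanish.\<close>

lemma link_part_boundary:
  assumes "Poly_Mapping.keys c \<subseteq> order_complex Q" "\<And>x. x \<in> Q \<Longrightarrow> \<not> x < a"
  shows "frag_extend (link_part a) (simplicial_boundary c)
    = - simplicial_boundary (frag_extend (link_part a) c)"
  using assms(1)
proof (induction c rule: frag_induction)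
  case (one \<sigma>)
  show ?case
  proof (cases "a \<in> \<sigma>")
    case True
    define \<tau> where "\<tau> = \<sigma> - {a}"
    have \<tau>: "frag_of \<sigma> = cone a (frag_of \<tau>)"
      using True by (auto simp: \<tau>_def insert_absorb)
    have keys: "Poly_Mapping.keys (frag_of \<tau>) \<subseteq> simplices_above a"
      using order_complex_Diff_minimal[OF one True assms(2)] order_complex_above
      by (auto simp: \<tau>_def)
    have "frag_extend (link_part a) (frag_of \<tau>) = 0"
      by (intro link_part_eq_0) (auto simp: \<tau>_def)
    moreover have "frag_extend (link_part a) (cone a (simplicial_boundary (frag_of \<tau>)))
        = simplicial_boundary (frag_of \<tau>)"
      using keys_simplicial_boundary_above[OF keys]
      by (intro link_part_cone) (auto simp: simplices_above_def)
    ultimately have "frag_extend (link_part a) (simplicial_boundary (frag_of \<sigma>))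
        = - simplicial_boundary (frag_of \<tau>)"
      unfolding \<tau> simplicial_boundary_cone[OF keys] by simp
    then show ?thesis
      using True by (simp add: link_part_simps \<tau>_def)
  next
    case False
    then show ?thesis
      using keys_simplicial_boundary[of "frag_of \<sigma>"]
      by (subst link_part_eq_0) (auto simp: link_part_simps)
  qed
qed auto

text \<open>Adding the apex \<open>a\<close> to the simplices that avoid it is a contraction of the cone over \<open>a\<close>.\<close>

lemma cone_acyclic:
  assumes keys: "Poly_Mapping.keys c \<subseteq> order_complex (insert a {x \<in> Q. a < x})"
    and cycle: "simplicial_boundary c = 0"
  obtains d where "c = simplicial_boundary (cone a d)" "Poly_Mapping.keys d \<subseteq> Poly_Mapping.keys c"
    "Poly_Mapping.keys d \<subseteq> order_complex {x \<in> Q. a < x}"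
proof -
  \<comment> \<open>The chain is split into the part \<open>d\<close> avoiding the apex and the cone
    over the link part \<open>e\<close>.\<close>
  define d where "d = frag_extend (\<lambda>\<sigma>. if a \<in> \<sigma> then 0 else frag_of \<sigma>) c"
  define e where "e = frag_extend (link_part a) c"
  have keys_d: "Poly_Mapping.keys d \<subseteq> {\<sigma> \<in> Poly_Mapping.keys c. a \<notin> \<sigma>}"
    unfolding d_def by (rule order_trans[OF keys_frag_extend]) (auto split: if_splits)
  then have d: "Poly_Mapping.keys d \<subseteq> order_complex {x \<in> Q. a < x}"
    using keys by (auto simp: order_complex_def)
  have e: "Poly_Mapping.keys e \<subseteq> order_complex {x \<in> Q. a < x}"
    unfolding e_def using keys
    by (intro order_trans[OF keys_link_part]) (auto simp: order_complex_def chain_def)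
  have c: "c = d + cone a e"
    unfolding d_def e_def using subset_UNIV[of "Poly_Mapping.keys c"]
  proof (induction c rule: frag_induction)
    case (one \<sigma>)
    then show ?case
      by (cases "a \<in> \<sigma>") (auto simp: link_part_simps insert_absorb)
  qed (auto simp: frag_extend_diff algebra_simps)
  have above: "Poly_Mapping.keys d \<subseteq> simplices_above a" "Poly_Mapping.keys e \<subseteq> simplices_above a"
    using d e order_complex_above by blast+
  note above' = above[THEN keys_simplicial_boundary_above]
  \<comment> \<open>Taking the link part at \<open>a\<close> isolates the simplices through the apex
    and shows that \<open>e\<close> is a cycle. What is left says that the boundary of
    \<open>d\<close> is \<open>- e\<close>, so the cone over \<open>d\<close> has boundary
    \<open>d + cone a e\<close>, which is \<open>c\<close>.\<close>
  have cycle': "simplicial_boundary d + e - cone a (simplicial_boundary e) = 0"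
    using cycle by (simp add: c simplicial_boundary_cone above algebra_simps)
  have "frag_extend (link_part a) (simplicial_boundary d) = 0" "frag_extend (link_part a) e = 0"
    "frag_extend (link_part a) (cone a (simplicial_boundary e)) = simplicial_boundary e"
    using above above' by (auto intro!: link_part_eq_0 link_part_cone simp: simplices_above_def)
  with arg_cong[OF cycle', of "frag_extend (link_part a)"] have "simplicial_boundary e = 0"
    by simp
  with cycle' have "simplicial_boundary d = - e"
    by (simp add: eq_neg_iff_add_eq_0)
  then have "simplicial_boundary (cone a d) = c"
    by (simp add: simplicial_boundary_cone above c)
  with keys_d d show thesis
    by (intro that) auto
qed

section \<open>Homology of order complexes\<close>

abbreviation order_complex_chains :: "int \<Rightarrow> 'a::order set \<Rightarrow> ('a set \<Rightarrow>\<^sub>0 int) set" where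
  "order_complex_chains i Q \<equiv> carrier (simplicial_chain_group i (order_complex Q))"

lemma simplicial_chains_iff:
  "c \<in> carrier (simplicial_chain_group i K) \<longleftrightarrow>
    (\<forall>\<sigma>\<in>Poly_Mapping.keys c. \<sigma> \<in> K \<and> int (card \<sigma>) = i + 1)"
  by (auto simp: simplicial_chain_group_def)

lemma frag_subgroup_chains: "frag_subgroup (carrier (simplicial_chain_group i K))"
  unfolding frag_subgroup_def
proof (intro conjI ballI)
  fix x y assume "x \<in> carrier (simplicial_chain_group i K)" "y \<in> carrier (simplicial_chain_group i K)"
  then show "x - y \<in> carrier (simplicial_chain_group i K)"
    using keys_diff[of x y] unfolding simplicial_chains_iff by blast
qed (simp add: simplicial_chains_iff)

lemma simplicial_cycles_iff:
  "c \<in> simplicial_cycles i K \<longleftrightarrow>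
    c \<in> carrier (simplicial_chain_group i K) \<and> simplicial_boundary c = 0"
  by (simp add: simplicial_cycles_def kernel_def simplicial_chain_group_def)

lemma frag_subgroup_cycles: "frag_subgroup (simplicial_cycles i K)"
  using frag_subgroup_chains[of i K] by (auto simp: frag_subgroup_def simplicial_cycles_iff)

lemma frag_subgroup_boundaries: "frag_subgroup (simplicial_boundaries i K)"
  unfolding frag_subgroup_def
proof (intro conjI ballI)
  note chains = frag_subgroup_chains[of "i + 1" K]
  show "0 \<in> simplicial_boundaries i K"
    unfolding simplicial_boundaries_def by (rule image_eqI[of _ _ 0]) (auto intro: frag_subgroup_zero[OF chains])
  fix x y assume "x \<in> simplicial_boundaries i K" "y \<in> simplicial_boundaries i K"
  then obtain x' y' where "x = simplicial_boundary x'" "x' \<in> carrier (simplicial_chain_group (i + 1) K)"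
    "y = simplicial_boundary y'" "y' \<in> carrier (simplicial_chain_group (i + 1) K)"
    by (auto simp: simplicial_boundaries_def)
  then show "x - y \<in> simplicial_boundaries i K"
    unfolding simplicial_boundaries_def
    by (intro image_eqI[of _ _ "x' - y'"]) (auto intro: frag_subgroup_diff[OF chains])
qed

section \<open>Supports and degrees under boundary, cone and link\<close>

lemma keys_order_complex_chain:
  "c \<in> order_complex_chains i Q \<Longrightarrow> Poly_Mapping.keys c \<subseteq> order_complex Q"
  by (auto simp: simplicial_chains_iff)

lemma order_complex_chains_mono:
  "Q \<subseteq> R \<Longrightarrow> order_complex_chains i Q \<subseteq> order_complex_chains i R"
  unfolding simplicial_chains_iff subset_iff order_complex_def by blast

lemma order_complex_Diff: "\<sigma> \<in> order_complex Q \<Longrightarrow> \<sigma> - X \<in> order_complex Q"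
  by (auto simp: order_complex_def chain_def)

lemma simplicial_boundary_chains:
  assumes "c \<in> order_complex_chains i Q"
  shows "simplicial_boundary c \<in> order_complex_chains (i - 1) Q"
  unfolding simplicial_chains_iff
proof
  fix \<tau> assume "\<tau> \<in> Poly_Mapping.keys (simplicial_boundary c)"
  from subsetD[OF keys_simplicial_boundary this] obtain \<sigma> v
    where \<sigma>: "\<sigma> \<in> Poly_Mapping.keys c" "v \<in> \<sigma>" "\<tau> = \<sigma> - {v}"
    by blast
  with assms have "\<sigma> \<in> order_complex Q" "int (card \<sigma>) = i + 1"
    by (auto simp: simplicial_chains_iff)
  moreover have "Suc (card \<tau>) = card \<sigma>"
    unfolding \<sigma>(3) using \<open>\<sigma> \<in> order_complex Q\<close> \<sigma>(2)
    by (intro card_Suc_Diff1) (auto simp: order_complex_def)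
  ultimately show "\<tau> \<in> order_complex Q \<and> int (card \<tau>) = i - 1 + 1"
    using \<sigma> order_complex_Diff by auto
qed

lemma cone_chains:
  assumes "c \<in> order_complex_chains i {x \<in> Q. a < x}" "a \<in> Q"
  shows "cone a c \<in> order_complex_chains (i + 1) Q"
  unfolding simplicial_chains_iff
proof
  fix \<tau> assume "\<tau> \<in> Poly_Mapping.keys (cone a c)"
  from subsetD[OF keys_cone this] obtain \<sigma>
    where \<sigma>: "\<sigma> \<in> Poly_Mapping.keys c" "\<tau> = insert a \<sigma>"
    by blast
  with assms have "\<sigma> \<in> order_complex {x \<in> Q. a < x}" "int (card \<sigma>) = i + 1"
    by (auto simp: simplicial_chains_iff)
  moreover from this have "a \<notin> \<sigma>"
    by (auto simp: order_complex_def)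
  moreover from this have "card \<tau> = Suc (card \<sigma>)"
    unfolding \<sigma>(2) using \<open>\<sigma> \<in> order_complex {x \<in> Q. a < x}\<close>
    by (intro card_insert_disjoint) (auto simp: order_complex_def)
  moreover have "\<tau> \<in> order_complex Q"
    unfolding \<sigma>(2) using \<open>\<sigma> \<in> order_complex {x \<in> Q. a < x}\<close> assms(2)
    unfolding order_complex_def chain_def by (auto dest: less_imp_le)
  ultimately show "\<tau> \<in> order_complex Q \<and> int (card \<tau>) = i + 1 + 1"
    by simp
qed

lemma link_part_chains:
  assumes "c \<in> order_complex_chains i Q" "\<And>x. x \<in> Q \<Longrightarrow> \<not> x < a"
  shows "frag_extend (link_part a) c \<in> order_complex_chains (i - 1) {x \<in> Q. a < x}"
  unfolding simplicial_chains_iff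
proof
  fix \<tau> assume "\<tau> \<in> Poly_Mapping.keys (frag_extend (link_part a) c)"
  from subsetD[OF keys_link_part this] obtain \<sigma>
    where \<sigma>: "\<sigma> \<in> Poly_Mapping.keys c" "a \<in> \<sigma>" "\<tau> = \<sigma> - {a}"
    by blast
  with assms(1) have "\<sigma> \<in> order_complex Q" "int (card \<sigma>) = i + 1"
    by (auto simp: simplicial_chains_iff)
  moreover have "Suc (card \<tau>) = card \<sigma>"
    unfolding \<sigma>(3) using \<open>\<sigma> \<in> order_complex Q\<close> \<sigma>(2)
    by (intro card_Suc_Diff1) (auto simp: order_complex_def)
  ultimately show "\<tau> \<in> order_complex {x \<in> Q. a < x} \<and> int (card \<tau>) = i - 1 + 1"
    using \<sigma> order_complex_Diff_minimal assms(2) by auto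
qed

section \<open>Ranks of homology groups as sizes of rational bases\<close>

lemma simplicial_boundaries_subset_cycles:
  "simplicial_boundaries i (order_complex Q) \<subseteq> simplicial_cycles i (order_complex Q)"
proof
  fix b assume "b \<in> simplicial_boundaries i (order_complex Q)"
  then obtain c where c: "c \<in> order_complex_chains (i + 1) Q" "b = simplicial_boundary c"
    by (auto simp: simplicial_boundaries_def)
  then show "b \<in> simplicial_cycles i (order_complex Q)"
    using simplicial_boundary_chains[OF c(1)] simplicial_boundary_boundary[OF keys_order_complex_chain[OF c(1)]]
    by (simp add: simplicial_cycles_iff)
qed

lemma homology_rank_eq_card:
  assumes "rational_basis_modulo (simplicial_cycles i (order_complex Q))
    (simplicial_boundaries i (order_complex Q)) z I"
  shows "abelian_group_rank (reduced_simplicial_homology i (order_complex Q)) = card I"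
  unfolding reduced_simplicial_homology_def simplicial_chain_group_def
proof (rule abelian_group_rank_quotient[OF frag_subgroup_cycles _ frag_subgroup_boundaries
      simplicial_boundaries_subset_cycles assms])
  show "simplicial_cycles i (order_complex Q)
      \<subseteq> carrier (free_Abelian_group {\<sigma> \<in> order_complex Q. int (card \<sigma>) = i + 1})"
    using simplicial_cycles_iff[of _ i "order_complex Q"] unfolding simplicial_chain_group_def by blast
qed

lemma homology_rational_basis_exists:
  assumes "finite Q"
  shows "\<exists>E. rational_basis_modulo (simplicial_cycles i (order_complex Q))
    (simplicial_boundaries i (order_complex Q)) (\<lambda>x. x) E"
proof (rule rational_basis_modulo_exists[OF frag_subgroup_boundaries])
  show "finite (order_complex Q)"
    using assms by (rule finite_subset[rotated, OF finite_Pow_iff[THEN iffD2]]) (auto simp: order_complex_def)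
  show "Poly_Mapping.keys c \<subseteq> order_complex Q" if "c \<in> simplicial_cycles i (order_complex Q)" for c
    using that keys_order_complex_chain by (auto simp: simplicial_cycles_iff)
qed

text \<open>Being minimal, \<open>b\<close> is not above \<open>a\<close> and so is no vertex of
  \<open>c\<close>; it can occur in the cone only as the apex.\<close>

lemma link_part_cone_chain:
  assumes "c \<in> order_complex_chains i {x \<in> Q. a < x}" "a \<in> Q" "\<And>x. x \<in> Q \<Longrightarrow> \<not> x < b"
  shows "frag_extend (link_part b) (cone a c) = (if b = a then c else 0)"
proof -
  have notin: "b \<notin> \<sigma>" if "\<sigma> \<in> Poly_Mapping.keys c" for \<sigma>
    using that assms by (auto simp: simplicial_chains_iff order_complex_def)
  show ?thesis
  proof (cases "b = a")
    case True
    with notin show ?thesis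
      by (simp add: link_part_cone)
  next
    case False
    with notin have "frag_extend (link_part b) (cone a c) = 0"
      using keys_cone[of a c] by (intro link_part_eq_0) auto
    with False show ?thesis
      by simp
  qed
qed

lemma simplicial_boundary_cone_chain:
  assumes "c \<in> order_complex_chains i {x \<in> Q. a < x}"
  shows "simplicial_boundary (cone a c) = c - cone a (simplicial_boundary c)"
  using keys_order_complex_chain[OF assms] order_complex_above
  by (intro simplicial_boundary_cone) blast

text \<open>Collapsing the contractible order complex of \<open>Q - A\<close> leaves a wedge of
  suspensions of the links of the elements of \<open>A\<close>, hence the shift in degree. On
  chains, the link parts act as projections onto the homology of the links, and the basis of a
  direct sum is transported by suspension.\<close>

lemma homology_rank_minimal_elements:
  fixes Q :: "'a::order set"
  assumes "finite Q" "A \<subseteq> Q" "p \<in> Q - A"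
    and minimal: "\<And>a x. a \<in> insert p A \<Longrightarrow> x \<in> Q \<Longrightarrow> \<not> x < a"
    and apex: "\<And>x. x \<in> Q - A \<Longrightarrow> p \<le> x"
    and above: "\<And>a x. a \<in> A \<Longrightarrow> x \<in> Q \<Longrightarrow> a < x \<Longrightarrow> p < x"
  shows "abelian_group_rank (reduced_simplicial_homology i (order_complex Q))
    = (\<Sum>a\<in>A. abelian_group_rank (reduced_simplicial_homology (i - 1) (order_complex {x \<in> Q. a < x})))"
proof -
  let ?U = "\<lambda>a. {x \<in> Q. a < x}"
  let ?Z = "simplicial_cycles i (order_complex Q)"
  let ?B = "simplicial_boundaries i (order_complex Q)"
  let ?Z' = "\<lambda>a. simplicial_cycles (i - 1) (order_complex (?U a))"
  let ?B' = "\<lambda>a. simplicial_boundaries (i - 1) (order_complex (?U a))"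
  let ?link = "\<lambda>a. frag_extend (link_part a)"
  have "finite A"
    using assms finite_subset by blast
  have "\<forall>a. \<exists>E. rational_basis_modulo (?Z' a) (?B' a) (\<lambda>x. x) E"
    using \<open>finite Q\<close> by (intro allI homology_rational_basis_exists) auto
  from choice[OF this] obtain E
    where "\<forall>a. rational_basis_modulo (?Z' a) (?B' a) (\<lambda>x. x) (E a)" ..
  then have E: "rational_basis_modulo (?Z' a) (?B' a) (\<lambda>x. x) (E a)" for a ..
  have "rational_basis_modulo ?Z ?B (\<lambda>(a, x). cone a x - cone p x) (Sigma A E)"
  proof (rule rational_basis_modulo_Sigma[OF \<open>finite A\<close> frag_subgroup_cycles frag_subgroup_boundaries E])
    show "?link a w \<in> ?Z' a" if "a \<in> A" "w \<in> ?Z" for a w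
      using that minimal link_part_chains[of w i Q a] link_part_boundary[of w Q a]
        keys_order_complex_chain[of w i Q]
      by (auto simp: simplicial_cycles_iff)
  next
    fix a w assume a: "a \<in> A" and w: "w \<in> ?Z' a"
    then have chain: "w \<in> order_complex_chains (i - 1) (?U a)" and cycle: "simplicial_boundary w = 0"
      by (auto simp: simplicial_cycles_iff)
    \<comment> \<open>Whatever lies above \<open>a\<close> lies above \<open>p\<close>, so the same
      \<open>w\<close> can be coned off from \<open>p\<close> as well.\<close>
    have chain': "w \<in> order_complex_chains (i - 1) (?U p)"
      using chain order_complex_chains_mono[of "?U a" "?U p" "i - 1"] above[OF a] by auto
    have "cone a w \<in> order_complex_chains i Q" "cone p w \<in> order_complex_chains i Q"
      using cone_chains[OF chain] cone_chains[OF chain'] a assms by auto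
    \<comment> \<open>As \<open>w\<close> is a cycle, both cones have boundary \<open>w\<close>;
      their difference is the suspension of \<open>w\<close> with poles \<open>a\<close> and
      \<open>p\<close>.\<close>
    then show "cone a w - cone p w \<in> ?Z"
      by (simp add: simplicial_cycles_iff frag_subgroup_diff[OF frag_subgroup_chains] cycle
          simplicial_boundary_cone_chain[OF chain] simplicial_boundary_cone_chain[OF chain'])
    \<comment> \<open>Since \<open>p\<close> is not in \<open>A\<close>, the cone from
      \<open>p\<close> has no link part at elements of \<open>A\<close>.\<close>
    show "?link b (cone a w - cone p w) = (if b = a then w else 0)" if "b \<in> A" for b
      using that a assms minimal link_part_cone_chain[OF chain, of b] link_part_cone_chain[OF chain', of b]
      by auto
  next
    fix w assume w: "w \<in> ?Z"
    then have chain: "w \<in> order_complex_chains i Q" and cycle: "simplicial_boundary w = 0"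
      by (auto simp: simplicial_cycles_iff)
    show "w \<in> ?B \<longleftrightarrow> (\<forall>a\<in>A. ?link a w \<in> ?B' a)"
    proof
      assume "w \<in> ?B"
      then obtain y where y: "y \<in> order_complex_chains (i + 1) Q" "w = simplicial_boundary y"
        by (auto simp: simplicial_boundaries_def)
      show "\<forall>a\<in>A. ?link a w \<in> ?B' a"
      proof
        fix a assume a: "a \<in> A"
        \<comment> \<open>The sign compensates for the link part anticommuting with the
          boundary.\<close>
        then have "?link a w = simplicial_boundary (- ?link a y)"
          using link_part_boundary[OF keys_order_complex_chain[OF y(1)], of a] minimal y(2) by simp
        moreover have "- ?link a y \<in> order_complex_chains i (?U a)"
          using link_part_chains[OF y(1), of a] a minimal
          by (intro frag_subgroup_uminus[OF frag_subgroup_chains]) simp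
        ultimately show "?link a w \<in> ?B' a"
          unfolding simplicial_boundaries_def by (intro image_eqI) auto
      qed
    next
      assume "\<forall>a\<in>A. ?link a w \<in> ?B' a"
      then have "\<forall>a\<in>A. \<exists>v\<in>order_complex_chains i (?U a). ?link a w = simplicial_boundary v"
        by (auto simp: simplicial_boundaries_def)
      then obtain v where v: "\<And>a. a \<in> A \<Longrightarrow> v a \<in> order_complex_chains i (?U a)"
        "\<And>a. a \<in> A \<Longrightarrow> ?link a w = simplicial_boundary (v a)"
        by metis
      \<comment> \<open>Cones over the bounding chains \<open>v a\<close>: the boundary of
        \<open>s\<close> has link part minus the boundary of \<open>v a\<close> at each
        \<open>a\<close>, which cancels the link part of \<open>w\<close>.\<close>
      define s where "s = (\<Sum>a\<in>A. cone a (v a))"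
      have s: "s \<in> order_complex_chains (i + 1) Q"
        unfolding s_def using cone_chains v(1) assms
        by (intro frag_subgroup_sum[OF frag_subgroup_chains]) blast
      have link_s: "?link b s = v b" if "b \<in> A" for b
      proof -
        have "?link b s = (\<Sum>a\<in>A. if b = a then v a else 0)"
          unfolding s_def frag_extend_sum[OF \<open>finite A\<close>] o_def
          using link_part_cone_chain[OF v(1)] assms minimal that by (intro sum.cong) auto
        then show ?thesis
          using that \<open>finite A\<close> by simp
      qed
      define y where "y = w + simplicial_boundary s"
      have y: "y \<in> order_complex_chains i Q"
        unfolding y_def using chain simplicial_boundary_chains[OF s]
        by (intro frag_subgroup_add[OF frag_subgroup_chains]) auto
      \<comment> \<open>All link parts of \<open>y\<close> at elements of \<open>A\<close> vanish,
        so \<open>y\<close> is a chain of \<open>Q - A\<close>, that is, of the cone with apex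
        \<open>p\<close>.\<close>
      have "\<sigma> \<in> order_complex (insert p (?U p))" if \<sigma>: "\<sigma> \<in> Poly_Mapping.keys y" for \<sigma>
      proof -
        have notin: "a \<notin> \<sigma>" if a: "a \<in> A" for a
        proof
          assume "a \<in> \<sigma>"
          have "?link a y = 0"
            using v(2) link_s a minimal
              link_part_boundary[OF keys_order_complex_chain[OF s], of a]
            by (simp add: y_def)
          then show False
            using lookup_link_part[of a y "\<sigma> - {a}"] \<sigma> \<open>a \<in> \<sigma>\<close>
            by (simp add: insert_absorb in_keys_iff)
        qed
        have "\<sigma> \<in> order_complex Q"
          using y \<sigma> by (simp add: simplicial_chains_iff)
        moreover have "x \<in> insert p (?U p)" if "x \<in> \<sigma>" for x
          using calculation that notin[of x] apex[of x] by (auto simp: order_complex_def less_le)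
        ultimately show ?thesis
          unfolding order_complex_def by blast
      qed
      moreover have "simplicial_boundary y = 0"
        using cycle simplicial_boundary_boundary[OF keys_order_complex_chain[OF s]]
        by (simp add: y_def)
      ultimately obtain d where d: "y = simplicial_boundary (cone p d)"
        "Poly_Mapping.keys d \<subseteq> Poly_Mapping.keys y"
        "Poly_Mapping.keys d \<subseteq> order_complex (?U p)"
        using cone_acyclic[of y p Q] by blast
      \<comment> \<open>The degree of \<open>d\<close> is inherited from \<open>y\<close>, whose
        support contains that of \<open>d\<close>.\<close>
      have "d \<in> order_complex_chains i (?U p)"
        using d y unfolding simplicial_chains_iff by blast
      then have "cone p d \<in> order_complex_chains (i + 1) Q"
        using cone_chains assms by blast
      moreover have "w = simplicial_boundary (cone p d - s)"
        using d(1) by (simp add: y_def algebra_simps)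
      ultimately show "w \<in> ?B"
        unfolding simplicial_boundaries_def using s
        by (intro image_eqI[of _ _ "cone p d - s"] frag_subgroup_diff[OF frag_subgroup_chains])
    qed
  qed
  then have "abelian_group_rank (reduced_simplicial_homology i (order_complex Q)) = card (Sigma A E)"
    by (rule homology_rank_eq_card)
  also have "\<dots> = (\<Sum>a\<in>A. card (E a))"
    using \<open>finite A\<close> E by (intro card_SigmaI) (auto simp: rational_basis_modulo_def)
  also have "\<dots> = (\<Sum>a\<in>A. abelian_group_rank (reduced_simplicial_homology (i - 1) (order_complex (?U a))))"
    using homology_rank_eq_card[OF E] by simp
  finally show ?thesis .
qed

section \<open>Bounded interval orders\<close>

lemma bounded_poset_bot:
  assumes "bounded_poset P"
  shows poset_bot_in: "poset_bot P \<in> P" and poset_bot_le: "x \<in> P \<Longrightarrow> poset_bot P \<le> x"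
proof -
  obtain b where "b \<in> P" "\<And>x. x \<in> P \<Longrightarrow> b \<le> x"
    using assms by (auto simp: bounded_poset_def)
  then have "poset_bot P = b"
    unfolding poset_bot_def by (intro Least_equality) auto
  with \<open>b \<in> P\<close> \<open>\<And>x. x \<in> P \<Longrightarrow> b \<le> x\<close>
  show "poset_bot P \<in> P" "x \<in> P \<Longrightarrow> poset_bot P \<le> x"
    by auto
qed

lemma bounded_poset_top:
  assumes "bounded_poset P"
  shows poset_top_in: "poset_top P \<in> P" and poset_top_ge: "x \<in> P \<Longrightarrow> x \<le> poset_top P"
proof -
  obtain b where "b \<in> P" "\<And>x. x \<in> P \<Longrightarrow> x \<le> b"
    using assms by (auto simp: bounded_poset_def)
  then have "poset_top P = b"
    unfolding poset_top_def by (intro Greatest_equality) auto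
  with \<open>b \<in> P\<close> \<open>\<And>x. x \<in> P \<Longrightarrow> x \<le> b\<close>
  show "poset_top P \<in> P" "x \<in> P \<Longrightarrow> x \<le> poset_top P"
    by auto
qed

text \<open>With an empty proper part every chain lies in a set of at most two elements and so has
  at most one step.\<close>

lemma proper_part_nonempty:
  assumes P: "bounded_poset P" and length: "poset_length P \<ge> 2"
  shows "proper_part P \<noteq> {}"
proof
  assume "proper_part P = {}"
  then have "P \<subseteq> {poset_bot P, poset_top P}"
    by (auto simp: proper_part_def)
  then have card: "card C - 1 \<le> 1" if "C \<subseteq> P" for C
    using card_mono[of "{poset_bot P, poset_top P}" C] that
      card_insert_le_m1[of 2 "{poset_top P}" "poset_bot P"] by force
  let ?L = "{card C - 1 |C. C \<subseteq> P \<and> Complete_Partial_Order.chain (\<le>) C \<and>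
    poset_bot P \<in> C \<and> poset_top P \<in> C}"
  have "?L \<subseteq> {..1}"
    using card by auto
  moreover from this have "finite ?L"
    by (rule finite_subset) simp
  \<comment> \<open>\<open>Max\<close> can be evaluated only on a finite nonempty set; the chain of
    the two bounds provides an element.\<close>
  moreover have "Complete_Partial_Order.chain (\<le>) {poset_bot P, poset_top P}"
    using poset_bot_le[OF P poset_top_in[OF P]] by (auto simp: chain_def)
  then have "card {poset_bot P, poset_top P} - 1 \<in> ?L"
    using poset_bot_in[OF P] poset_top_in[OF P] by blast
  then have "?L \<noteq> {}"
    by blast
  ultimately have "Max ?L \<le> 1"
    using Max_in[of ?L] by auto
  then show False
    using length by (simp add: poset_length_def)
qed

text \<open>Length at least 2 supplies an element strictly between the bounds, so the top is not an
  atom and every atom lies in the proper part.\<close>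

lemma poset_atoms_eq_minimal:
  assumes P: "bounded_poset P" and length: "poset_length P \<ge> 2"
  shows "poset_atoms P = {a \<in> proper_part P. \<forall>x\<in>proper_part P. \<not> x < a}"
proof -
  obtain q where "q \<in> P" "q \<noteq> poset_bot P" "q \<noteq> poset_top P"
    using proper_part_nonempty[OF assms] by (auto simp: proper_part_def)
  then have q: "q \<in> P" "poset_bot P < q" "q < poset_top P"
    using poset_bot_le[OF P] poset_top_ge[OF P] by (auto simp: less_le)
  have "a \<in> poset_atoms P \<longleftrightarrow> a \<in> proper_part P \<and> (\<forall>x\<in>proper_part P. \<not> x < a)" for a
  proof
    assume "a \<in> poset_atoms P"
    then have a: "a \<in> P" "poset_bot P < a" "\<And>z. z \<in> P \<Longrightarrow> poset_bot P < z \<Longrightarrow> \<not> z < a"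
      by (auto simp: poset_atoms_def covered_by_def)
    then have "a \<noteq> poset_top P"
      using q by blast
    with a show "a \<in> proper_part P \<and> (\<forall>x\<in>proper_part P. \<not> x < a)"
      using poset_bot_le[OF P] by (auto simp: proper_part_def less_le)
  next
    assume a: "a \<in> proper_part P \<and> (\<forall>x\<in>proper_part P. \<not> x < a)"
    then have "poset_bot P < a" "a \<in> P"
      using poset_bot_le[OF P] by (auto simp: proper_part_def less_le)
    moreover have "\<not> z < a" if "z \<in> P" "poset_bot P < z" for z
      using a that poset_top_ge[OF P \<open>a \<in> P\<close>] by (auto simp: proper_part_def)
    ultimately show "a \<in> poset_atoms P"
      using poset_bot_in[OF P] by (auto simp: poset_atoms_def covered_by_def)
  qed
  then show ?thesis
    by blast
qed

text \<open>Identifies the link of \<open>a\<close>, on which the gluing argument works, with the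
  proper part of the interval from \<open>a\<close> to the top.\<close>

lemma proper_part_upper_interval:
  assumes P: "bounded_poset P" and a: "a \<in> proper_part P"
  shows "proper_part (P \<inter> {a..poset_top P}) = {x \<in> proper_part P. a < x}"
proof -
  have "a \<in> P" and le: "a \<le> poset_top P" and top: "poset_top P \<in> P"
    using a poset_top_ge[OF P] poset_top_in[OF P] by (auto simp: proper_part_def)
  have "poset_bot (P \<inter> {a..poset_top P}) = a"
    unfolding poset_bot_def using \<open>a \<in> P\<close> le by (intro Least_equality) auto
  moreover have "poset_top (P \<inter> {a..poset_top P}) = poset_top P"
    using top le unfolding poset_top_def[of "P \<inter> _"] by (intro Greatest_equality) auto
  ultimately show ?thesis
    using \<open>a \<in> P\<close> a poset_bot_le[OF P \<open>a \<in> P\<close>] poset_top_ge[OF P] unfolding proper_part_def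
    by (auto simp: less_le)
qed

text \<open>The upper sets are nested: a cover \<open>c\<close> of \<open>a\<close> with
  \<open>\<not> b < c\<close> gives \<open>r a < l c \<le> r b < l x\<close>.\<close>

lemma atom_less_imp_above_subset:
  assumes "interval_order P" "atom_less P a b" "b \<in> P" "x \<in> P" "b < x"
  shows "a < x"
proof -
  obtain l r :: "'a \<Rightarrow> real" where lr: "\<And>x y. x \<in> P \<Longrightarrow> y \<in> P \<Longrightarrow> x < y \<longleftrightarrow> r x < l y"
    using assms(1) by (auto simp: interval_order_def)
  obtain c where "a \<in> P" "c \<in> P" "a < c" "\<not> b < c"
    using assms(2) by (auto simp: atom_less_def covered_by_def)
  with lr assms show ?thesis
    by force
qed

theorem corollary12:
  fixes P :: "'a::order set" and a0 :: 'a and i :: int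
  assumes "bounded_poset P"
    and "interval_order P"
    and "poset_length P \<ge> 2"
    and "smallest_atom P a0"
    and "i \<ge> 0"
  shows "reduced_betti i P =
    (\<Sum>a\<in>poset_atoms P - {a0}. reduced_betti (i - 1) (P \<inter> {a..poset_top P}))"
proof -
  let ?Q = "proper_part P" and ?A = "poset_atoms P - {a0}"
  have atoms: "poset_atoms P = {a \<in> ?Q. \<forall>x\<in>?Q. \<not> x < a}"
    using assms by (intro poset_atoms_eq_minimal)
  have a0: "a0 \<in> poset_atoms P" "\<And>b. b \<in> ?A \<Longrightarrow> atom_less P a0 b"
    using assms(4) by (auto simp: smallest_atom_def atom_le_def)
  have "finite ?Q" and sub: "?Q \<subseteq> P"
    using assms(1) by (auto simp: bounded_poset_def proper_part_def)
  have above: "a0 < x" if "a \<in> ?A" "x \<in> ?Q" "a < x" for a x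
    using that atoms sub a0(2) by (intro atom_less_imp_above_subset[OF assms(2), of a0 a x]) auto
  \<comment> \<open>Below \<open>x\<close> there is a minimal element \<open>a\<close> of the proper
    part, which is an atom. If \<open>x\<close> is neither \<open>a0\<close> nor another atom, then
    \<open>a < x\<close>, and either \<open>a\<close> is \<open>a0\<close> or nestedness of the
    upper sets gives \<open>a0 < x\<close>.\<close>
  have apex: "a0 \<le> x" if x: "x \<in> ?Q - ?A" for x
  proof (cases "x = a0")
    case False
    obtain a where a: "a \<in> ?Q" "a \<le> x" "\<And>b. b \<in> ?Q \<Longrightarrow> b \<le> a \<Longrightarrow> a = b"
      using finite_has_minimal2[OF \<open>finite ?Q\<close>, of x] x by auto
    then have "a \<in> poset_atoms P"
      unfolding atoms by (auto dest: less_imp_le)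
    then have "a < x"
      using x a(2) False by (auto simp: less_le)
    then show ?thesis
      using above[of a x] \<open>a \<in> poset_atoms P\<close> x by (cases "a = a0") (auto dest: less_imp_le)
  qed simp
  have "reduced_betti i P
      = (\<Sum>a\<in>?A. abelian_group_rank (reduced_simplicial_homology (i - 1) (order_complex {x \<in> ?Q. a < x})))"
    unfolding reduced_betti_def using \<open>finite ?Q\<close> atoms a0(1) above apex
    by (intro homology_rank_minimal_elements[where p = a0]) auto
  also have "\<dots> = (\<Sum>a\<in>?A. reduced_betti (i - 1) (P \<inter> {a..poset_top P}))"
    unfolding reduced_betti_def using assms(1) atoms
    by (intro sum.cong refl) (simp add: proper_part_upper_interval)
  finally show ?thesis .
qed

end
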